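(* Let $\|\cdot\|_1,\|\cdot\|_2,\dots$ be norms on $c_{00}$ such that $\|x\|_1\le\|x\|_2\le\cdots$ for all $x\in c_{00}$, and assume $\|x\|=\sup_k\|x\|_k$ is finite for every $x\in c_{00}$, so that it defines a norm $\|\cdot\|$ on $c_{00}$. Then one of the following holds: (1) there are $k\in\mathbb{N}$ and a constant $K>0$ such that $\|x\|\le K\|x\|_k$ for all $x\in c_{00}$; (2) for any increasing sequence $m_1<m_2<\cdots$ there are natural numbers $k_1<k_2<\cdots$ and vectors $x_i\in c_{00}$ such that $\dfrac{\|x_i\|_{k_{i+1}}}{\|x_i\|_{k_i}}\ge m_i$ for all $i=1,2,\dots$. Moreover, (1) is equivalent to (1$'$) there are $k\in\mathbb{N}$ and $K>0$ such that $\|x\|\le K\|x\|_k$ for all $x\in c_{00}$ with $\|x\|_{\ell_1}=1$; and (2) is equivalent to (2$'$) for any increasing sequence $m_1<m_2<\cdots$ there are natural numbers $k_1<k_2<\cdots$ and vectors $x_i\in c_{00}$ with $\|x_i\|_{\ell_1}=1$ and $\dfrac{\|x_i\|_{k_{i+1}}}{\|x_i\|_{k_i}}\ge m_i$ for all $i=1,2,\dots$.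
   Context: $c_{00}$ is the vector space of finitely supported real sequences and $\|\cdot\|_{\ell_1}$ is the $\ell_1$-norm on it: $\|\sum_n a_ne_n\|_{\ell_1}=\sum_n|a_n|$. *)

theory Defs
  imports "HOL-Analysis.Analysis" "HOL-Analysis.Finite_Function_Topology"
begin

text \<open>
  The space of finitely supported real sequences is the type of finitely supported functions
  from the naturals to the reals, with the real vector space structure of
  \<^theory>\<open>HOL-Analysis.Finite_Function_Topology\<close>. The class norm on that type is the
  l1-norm, see \<open>norm_c00\<close>.
\<close>

type_synonym c00 = "nat \<Rightarrow>\<^sub>0 real"

lemma norm_c00:
  fixes x :: c00
  shows "norm x = (\<Sum>n \<in> Poly_Mapping.keys x. \<bar>Poly_Mapping.lookup x n\<bar>)"
  by (simp add: norm_poly_mapping_def dist_poly_mapping_def)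

lemma scaleR_c00:
  fixes x :: c00
  shows "Poly_Mapping.lookup (a *\<^sub>R x) n = a * Poly_Mapping.lookup x n"
proof -
  have "finite {i. a * Poly_Mapping.lookup x i \<noteq> 0}"
    by (rule finite_subset[OF _ finite_lookup[of x]]) auto
  then show ?thesis
    by (simp add: scaleR_poly_mapping_def Abs_poly_mapping_inverse)
qed

definition is_norm :: "('a::real_vector \<Rightarrow> real) \<Rightarrow> bool" where
  "is_norm p \<longleftrightarrow>
     (\<forall>x. 0 \<le> p x) \<and>
     (\<forall>x. p x = 0 \<longleftrightarrow> x = 0) \<and>
     (\<forall>a x. p (a *\<^sub>R x) = \<bar>a\<bar> * p x) \<and>
     (\<forall>x y. p (x + y) \<le> p x + p y)"

text \<open>
  On the reals \<open>SUP\<close> is meaningful only for bounded families, so this is used together with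
  the assumption that the set of values at each \<open>x\<close> is bounded above.
\<close>

definition sup_norm :: "(nat \<Rightarrow> 'a \<Rightarrow> real) \<Rightarrow> 'a \<Rightarrow> real" where
  "sup_norm N x = (SUP k. N k x)"

end

theory Submission
  imports Defs
begin

text \<open>
  If no \<open>N k\<close> dominates the supremum norm, then for every \<open>k\<close> and \<open>c \<ge> 1\<close> some \<open>x\<close> satisfies
  \<open>c * N k x < sup_norm N x\<close>, hence \<open>c * N k x < N j x\<close> for some \<open>j\<close>, and monotonicity forces
  \<open>j > k\<close>. Iterating this chooses the indices one after the other. The normalised versions
  hold because both conditions are homogeneous in \<open>x\<close>.
\<close>

lemma is_norm_scaleR: "is_norm p \<Longrightarrow> p (a *\<^sub>R x) = \<bar>a\<bar> * p x"
  by (simp add: is_norm_def)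

lemma is_norm_pos: "is_norm p \<Longrightarrow> x \<noteq> 0 \<Longrightarrow> 0 < p x"
  unfolding is_norm_def by (metis less_eq_real_def)

lemma is_norm_zero: "is_norm p \<Longrightarrow> p 0 = 0"
  by (simp add: is_norm_def)

lemma is_norm_norm_c00: "is_norm (norm :: c00 \<Rightarrow> real)"
  unfolding is_norm_def by (auto simp: norm_triangle_ineq)

lemma sup_norm_upper:
  assumes "bdd_above (range (\<lambda>k. N k x))"
  shows "N k x \<le> sup_norm N x"
  unfolding sup_norm_def by (intro cSUP_upper assms) auto

text \<open>Nondegeneracy is inherited from the single norm \<open>N 0\<close>, which lies below the
  supremum. The triangle inequality and one half of homogeneity pass to the supremum because their
  right-hand sides bound every term of the family.\<close>

lemma is_norm_sup_norm:
  assumes N: "\<And>k. is_norm (N k)"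
    and bdd: "\<And>x. bdd_above (range (\<lambda>k. N k x))"
  shows "is_norm (sup_norm N)"
proof -
  have pos: "0 < sup_norm N x" if "x \<noteq> 0" for x
    using is_norm_pos[OF N that] sup_norm_upper[of N x 0, OF bdd] by (rule less_le_trans)
  have zero: "sup_norm N 0 = 0"
    by (simp add: sup_norm_def is_norm_zero[OF N])
  have le: "sup_norm N (a *\<^sub>R x) \<le> \<bar>a\<bar> * sup_norm N x" for a x
    unfolding sup_norm_def[of N "a *\<^sub>R x"]
    by (intro cSUP_least) (auto simp: is_norm_scaleR[OF N] intro!: mult_left_mono sup_norm_upper bdd)
  have scale: "sup_norm N (a *\<^sub>R x) = \<bar>a\<bar> * sup_norm N x" for a x
  proof (cases "a = 0")
    case False
    \<comment> \<open>The reverse inequality is \<open>le\<close> again, applied to the scalar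
      \<open>inverse a\<close> and the vector \<open>a *\<^sub>R x\<close>.\<close>
    have "sup_norm N x \<le> \<bar>inverse a\<bar> * sup_norm N (a *\<^sub>R x)"
      using le[of "inverse a" "a *\<^sub>R x"] False by simp
    then have "\<bar>a\<bar> * sup_norm N x \<le> sup_norm N (a *\<^sub>R x)"
      using False by (simp add: field_simps)
    with le show ?thesis by (rule antisym)
  qed (simp add: zero)
  have "sup_norm N (x + y) \<le> sup_norm N x + sup_norm N y" for x y
    unfolding sup_norm_def[of N "x + y"]
  proof (intro cSUP_least)
    fix k
    have "N k (x + y) \<le> N k x + N k y"
      using N[of k] by (simp add: is_norm_def)
    also have "\<dots> \<le> sup_norm N x + sup_norm N y"
      by (intro add_mono sup_norm_upper bdd)
    finally show "N k (x + y) \<le> sup_norm N x + sup_norm N y" .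
  qed simp
  moreover have "0 \<le> sup_norm N x" "sup_norm N x = 0 \<longleftrightarrow> x = 0" for x
    using pos[of x] zero by (cases "x = 0"; simp)+
  ultimately show ?thesis
    using scale by (simp add: is_norm_def)
qed

text \<open>A single step of the iteration: \<open>k\<close> is the index chosen last and
  \<open>c\<close> the ratio asked for next. Accordingly \<open>not_dom\<close> speaks of this one
  \<open>k\<close> only.\<close>

lemma ex_large_ratio:
  fixes N :: "nat \<Rightarrow> 'a::real_vector \<Rightarrow> real"
  assumes N: "\<And>k. is_norm (N k)"
    and mono: "\<And>k x. N k x \<le> N (Suc k) x"
    and bdd: "\<And>x. bdd_above (range (\<lambda>k. N k x))"
    and not_dom: "\<And>K. K > 0 \<Longrightarrow> \<exists>x. K * N k x < sup_norm N x"
  shows "\<exists>j>k. \<exists>x. x \<noteq> 0 \<and> c \<le> N j x / N k x"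
proof -
  \<comment> \<open>The maximum with 1 makes \<open>K\<close> positive, so that
    \<open>not_dom\<close> applies, and at least 1, so that \<open>j \<le> k\<close> would give
    \<open>N j x \<le> N k x \<le> K * N k x\<close>, against the choice of \<open>j\<close>. It
    also covers negative \<open>c\<close>.\<close>
  define K where "K = max c 1"
  obtain x where "K * N k x < sup_norm N x"
    using not_dom[of K] unfolding K_def by fastforce
  then obtain j where j: "K * N k x < N j x"
    by (auto simp: sup_norm_def less_cSUP_iff[OF _ bdd])
  have "x \<noteq> 0"
    using j by (auto simp: is_norm_zero[OF N])
  then have pos: "0 < N k x" by (rule is_norm_pos[OF N])
  have "k < j"
  proof (rule ccontr)
    assume "\<not> k < j"
    then have "N j x \<le> N k x"
      using lift_Suc_mono_le[of "\<lambda>k. N k x", OF mono, of j k] by simp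
    also have "\<dots> \<le> K * N k x"
      using pos by (simp add: K_def)
    finally show False using j by simp
  qed
  moreover have "c \<le> N j x / N k x"
  proof -
    have "c * N k x \<le> K * N k x"
      using pos by (intro mult_right_mono) (auto simp: K_def)
    also have "\<dots> \<le> N j x"
      using j by (rule less_imp_le)
    finally show ?thesis using pos by (simp add: pos_le_divide_eq)
  qed
  ultimately show ?thesis using \<open>x \<noteq> 0\<close> by blast
qed

lemma dominated_or_large_ratios:
  fixes N :: "nat \<Rightarrow> 'a::real_vector \<Rightarrow> real" and m :: "nat \<Rightarrow> real"
  assumes N: "\<And>k. is_norm (N k)"
    and mono: "\<And>k x. N k x \<le> N (Suc k) x"
    and bdd: "\<And>x. bdd_above (range (\<lambda>k. N k x))"
  obtains "\<exists>k. \<exists>K>0. \<forall>x. sup_norm N x \<le> K * N k x"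
  | k :: "nat \<Rightarrow> nat" and x :: "nat \<Rightarrow> 'a"
    where "strict_mono k" "\<And>i. x i \<noteq> 0 \<and> m i \<le> N (k (Suc i)) (x i) / N (k i) (x i)"
proof (cases "\<exists>k. \<exists>K>0. \<forall>x. sup_norm N x \<le> K * N k x")
  case False
  have step: "\<exists>j>k. \<exists>x. x \<noteq> 0 \<and> c \<le> N j x / N k x" for k c
    using False by (intro ex_large_ratio N mono bdd) (meson not_le)
  \<comment> \<open>Only the indices are chosen dependently. The relation between consecutive
    indices merely asserts that a suitable vector exists, so the vectors can be picked afterwards,
    independently for each \<open>i\<close>.\<close>
  obtain k where k: "\<And>i. k i < k (Suc i) \<and> (\<exists>x. x \<noteq> 0 \<and> m i \<le> N (k (Suc i)) x / N (k i) x)"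
    using dependent_nat_choice[of "\<lambda>_ _. True"
        "\<lambda>i k j. k < j \<and> (\<exists>x. x \<noteq> 0 \<and> m i \<le> N j x / N k x)"] step
    by auto
  then obtain x where "\<And>i. x i \<noteq> 0 \<and> m i \<le> N (k (Suc i)) (x i) / N (k i) (x i)"
    by metis
  moreover have "strict_mono k"
    using k by (simp add: strict_mono_Suc_iff)
  ultimately show ?thesis by (intro that(2))
qed (rule that(1))

text \<open>Both sides of the bound are multiplied by the same positive factor when a nonzero
  \<open>x\<close> is divided by \<open>r x\<close>, so the same \<open>K\<close> serves; at
  \<open>x = 0\<close> both sides vanish.\<close>

lemma bound_on_unit_sphere_iff:
  assumes p: "is_norm p" and q: "is_norm q" and r: "is_norm r"
  shows "(\<forall>x. r x = 1 \<longrightarrow> p x \<le> K * q x) \<longleftrightarrow> (\<forall>x. p x \<le> K * q x)"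
proof (intro iffI allI)
  fix x
  assume unit: "\<forall>x. r x = 1 \<longrightarrow> p x \<le> K * q x"
  show "p x \<le> K * q x"
  proof (cases "x = 0")
    case False
    then have pos: "0 < r x" by (rule is_norm_pos[OF r])
    then have "r (inverse (r x) *\<^sub>R x) = 1"
      by (simp add: is_norm_scaleR[OF r])
    with unit have "p (inverse (r x) *\<^sub>R x) \<le> K * q (inverse (r x) *\<^sub>R x)"
      by blast
    with pos show ?thesis
      by (simp add: is_norm_scaleR[OF p] is_norm_scaleR[OF q] field_simps)
  qed (simp add: is_norm_zero p q)
qed blast

text \<open>The quotient of two norms does not change when \<open>x\<close> is rescaled. The
  condition \<open>x \<noteq> 0\<close> excludes the quotient at the zero vector, which HOL
  evaluates to 0 and which would pass the test for every \<open>c \<le> 0\<close>; on the unit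
  sphere of \<open>r\<close> this exclusion is automatic.\<close>

lemma ratio_attained_on_unit_sphere_iff:
  assumes p: "is_norm p" and q: "is_norm q" and r: "is_norm r"
  shows "(\<exists>x. r x = 1 \<and> c \<le> p x / q x) \<longleftrightarrow> (\<exists>x. x \<noteq> 0 \<and> c \<le> p x / q x)"
proof
  assume "\<exists>x. r x = 1 \<and> c \<le> p x / q x"
  then show "\<exists>x. x \<noteq> 0 \<and> c \<le> p x / q x"
    using is_norm_zero[OF r] by (metis zero_neq_one)
next
  assume "\<exists>x. x \<noteq> 0 \<and> c \<le> p x / q x"
  then obtain x where x: "x \<noteq> 0" "c \<le> p x / q x" by blast
  then have pos: "0 < r x" by (intro is_norm_pos[OF r])
  then have "r (inverse (r x) *\<^sub>R x) = 1"
    by (simp add: is_norm_scaleR[OF r])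
  moreover have "c \<le> p (inverse (r x) *\<^sub>R x) / q (inverse (r x) *\<^sub>R x)"
    using x pos by (simp add: is_norm_scaleR[OF p] is_norm_scaleR[OF q])
  ultimately show "\<exists>x. r x = 1 \<and> c \<le> p x / q x" by blast
qed

theorem theorem8p1:
  fixes N :: "nat \<Rightarrow> c00 \<Rightarrow> real"
  assumes "\<And>k. is_norm (N k)"
    and "\<And>k x. N k x \<le> N (Suc k) x"
    and "\<And>x. bdd_above (range (\<lambda>k. N k x))"
  shows
    "is_norm (sup_norm N) \<and>
     ((\<exists>k. \<exists>K>0. \<forall>x. sup_norm N x \<le> K * N k x) \<or>
      (\<forall>m::nat \<Rightarrow> real. strict_mono m \<longrightarrow>
         (\<exists>(k::nat \<Rightarrow> nat) (x::nat \<Rightarrow> c00). strict_mono k \<and>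
            (\<forall>i. x i \<noteq> 0 \<and> m i \<le> N (k (Suc i)) (x i) / N (k i) (x i))))) \<and>
     ((\<exists>k. \<exists>K>0. \<forall>x. sup_norm N x \<le> K * N k x) \<longleftrightarrow>
      (\<exists>k. \<exists>K>0. \<forall>x. norm x = 1 \<longrightarrow> sup_norm N x \<le> K * N k x)) \<and>
     ((\<forall>m::nat \<Rightarrow> real. strict_mono m \<longrightarrow>
         (\<exists>(k::nat \<Rightarrow> nat) (x::nat \<Rightarrow> c00). strict_mono k \<and>
            (\<forall>i. x i \<noteq> 0 \<and> m i \<le> N (k (Suc i)) (x i) / N (k i) (x i)))) \<longleftrightarrow>
      (\<forall>m::nat \<Rightarrow> real. strict_mono m \<longrightarrow>
         (\<exists>(k::nat \<Rightarrow> nat) (x::nat \<Rightarrow> c00). strict_mono k \<and>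
            (\<forall>i. norm (x i) = 1 \<and> m i \<le> N (k (Suc i)) (x i) / N (k i) (x i)))))"
proof (intro conjI)
  note N = assms(1) and bdd = assms(3)
  show sup: "is_norm (sup_norm N)"
    by (intro is_norm_sup_norm N bdd)
  show "(\<exists>k. \<exists>K>0. \<forall>x. sup_norm N x \<le> K * N k x) \<or>
      (\<forall>m::nat \<Rightarrow> real. strict_mono m \<longrightarrow>
         (\<exists>(k::nat \<Rightarrow> nat) (x::nat \<Rightarrow> c00). strict_mono k \<and>
            (\<forall>i. x i \<noteq> 0 \<and> m i \<le> N (k (Suc i)) (x i) / N (k i) (x i))))"
  proof (cases "\<exists>k. \<exists>K>0. \<forall>x. sup_norm N x \<le> K * N k x")
    case False
    have "\<exists>(k::nat \<Rightarrow> nat) x. strict_mono k \<and>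
        (\<forall>i. x i \<noteq> 0 \<and> m i \<le> N (k (Suc i)) (x i) / N (k i) (x i))" for m
      \<comment> \<open>Of the two cases the first contradicts \<open>False\<close>, and the second
        supplies the indices and vectors for this \<open>m\<close>.\<close>
      by (rule dominated_or_large_ratios[where m = m, OF assms]) (use False in blast)+
    then show ?thesis by blast
  qed blast
  show "(\<exists>k. \<exists>K>0. \<forall>x. sup_norm N x \<le> K * N k x) \<longleftrightarrow>
      (\<exists>k. \<exists>K>0. \<forall>x. norm x = 1 \<longrightarrow> sup_norm N x \<le> K * N k x)"
    by (simp only: bound_on_unit_sphere_iff[OF sup N is_norm_norm_c00])
  \<comment> \<open>With \<open>k\<close> and \<open>m\<close> fixed, the choice principle turns the
    existence of a sequence of vectors into the existence of one vector for each \<open>i\<close>,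
    where the rescaling lemma applies.\<close>
  have "(\<exists>x :: nat \<Rightarrow> c00. strict_mono k \<and>
            (\<forall>i. x i \<noteq> 0 \<and> m i \<le> N (k (Suc i)) (x i) / N (k i) (x i))) \<longleftrightarrow>
        (\<exists>x :: nat \<Rightarrow> c00. strict_mono k \<and>
            (\<forall>i. norm (x i) = 1 \<and> m i \<le> N (k (Suc i)) (x i) / N (k i) (x i)))"
    for k :: "nat \<Rightarrow> nat" and m :: "nat \<Rightarrow> real"
    using ratio_attained_on_unit_sphere_iff[OF N N is_norm_norm_c00]
      choice_iff[of "\<lambda>i x. x \<noteq> 0 \<and> m i \<le> N (k (Suc i)) x / N (k i) x"]
      choice_iff[of "\<lambda>i x. norm x = 1 \<and> m i \<le> N (k (Suc i)) x / N (k i) x"]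
    by simp
  then show "(\<forall>m::nat \<Rightarrow> real. strict_mono m \<longrightarrow>
         (\<exists>(k::nat \<Rightarrow> nat) (x::nat \<Rightarrow> c00). strict_mono k \<and>
            (\<forall>i. x i \<noteq> 0 \<and> m i \<le> N (k (Suc i)) (x i) / N (k i) (x i)))) \<longleftrightarrow>
      (\<forall>m::nat \<Rightarrow> real. strict_mono m \<longrightarrow>
         (\<exists>(k::nat \<Rightarrow> nat) (x::nat \<Rightarrow> c00). strict_mono k \<and>
            (\<forall>i. norm (x i) = 1 \<and> m i \<le> N (k (Suc i)) (x i) / N (k i) (x i))))"
    by simp
qed

end
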